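(* Let $f:[0,\infty)\to\mathbb{R}$ be a function that is differentiable on $(0,\infty)$, let $0<u<v$, and suppose $f'\in L[u,v]$. If $|f'|$ is convex on $[u,v]$, then for each $x\in[u,v]$, $$\left|\frac{(v-x)(vf(v)-uf(x))+(x-u)(vf(x)-uf(u))}{(v-u)^2}-\frac{1}{v-u}\int_u^v f(\mu)\,d\mu\right|$$ $$\le \frac{(v-x)^2}{6(v-u)^2}\Big[(2u+v)|f'(x)|+(u+2v)|f'(v)|\Big]+\frac{(x-u)^2}{6(v-u)^2}\Big[(u+2v)|f'(x)|+(2u+v)|f'(u)|\Big].$$
   Context: $L[u,v]$ denotes the space of Lebesgue integrable functions on $[u,v]$. *)

theory Defs
  imports "HOL-Analysis.Analysis"
begin

end

theory Submission
  imports Defs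
begin

text \<open>
  Why the inequality holds. Split \<open>[u, v]\<close> at \<open>x\<close>. On each of the pieces \<open>[a, b]\<close> take the
  affine weight \<open>W\<close> that runs from \<open>(b - a) u\<close> at \<open>a\<close> to \<open>(b - a) v\<close> at \<open>b\<close>; its slope is
  \<open>v - u\<close>. Integrating \<open>W f'\<close> by parts gives
  \<open>(b - a) (v f b - u f a) - (v - u) \<integral>\<^sub>a\<^sup>b f\<close>, and the sum of these two quantities
  is \<open>(v - u)\<^sup>2\<close> times the expression inside the absolute value of the theorem.

  Since \<open>u\<close> and \<open>v\<close> are nonnegative, so is \<open>W\<close>. By convexity \<open>\<bar>f'\<bar>\<close> lies below its chord on
  \<open>[a, b]\<close>, and therefore \<open>\<bar>\<integral> W f'\<bar>\<close> is at most the integral of \<open>W\<close> times that chord, a product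
  of two affine functions. Its value yields the two brackets on the right-hand side
  (lemma \<open>by_parts_chord_bound\<close>).

  All integrals of \<open>W f'\<close> are Henstock-Kurzweil integrals. For these every derivative is
  integrable, so that integration by parts is just the fundamental theorem applied to \<open>W f\<close>.
\<close>

lemma affine_by_parts_has_integral:
  fixes f f' :: "real \<Rightarrow> real"
  assumes "a \<le> b"
    and f': "\<And>y. y \<in> {a..b} \<Longrightarrow> (f has_field_derivative f' y) (at y within {a..b})"
  shows "((\<lambda>y. (p * (b - y) + q * (y - a)) * f' y) has_integral
           (b - a) * (q * f b - p * f a) - (q - p) * integral {a..b} f) {a..b}"
proof -
  let ?W = "\<lambda>y. p * (b - y) + q * (y - a)"
  have "f integrable_on {a..b}"
    by (intro integrable_continuous_real DERIV_continuous_on[where D = f'] f')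
  then have f_int: "((\<lambda>y. (q - p) * f y) has_integral (q - p) * integral {a..b} f) {a..b}"
    by (intro has_integral_mult_right integrable_integral)
  have "((\<lambda>y. ?W y * f y) has_field_derivative ?W y * f' y + (q - p) * f y) (at y within {a..b})"
    if "y \<in> {a..b}" for y
    by (auto intro!: derivative_eq_intros f'[OF that] simp: algebra_simps)
  then have "((\<lambda>y. ?W y * f' y + (q - p) * f y) has_integral ?W b * f b - ?W a * f a) {a..b}"
    using \<open>a \<le> b\<close>
    by (intro fundamental_theorem_of_calculus) (auto simp: has_real_derivative_iff_has_vector_derivative)
  from has_integral_diff[OF this f_int] show ?thesis
    by (simp add: algebra_simps)
qed

lemma affine_product_has_integral:
  fixes a b p q A B :: real
  assumes "a \<le> b"
  shows "((\<lambda>y. (p * (b - y) + q * (y - a)) * (A * (b - y) + B * (y - a))) has_integral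
           (b - a) ^ 3 / 6 * ((2 * p + q) * A + (p + 2 * q) * B)) {a..b}"
proof -
  \<comment> \<open>The first term is a primitive of the mixed products: with \<open>s = y - a\<close> these are
    \<open>s (b - a - s)\<close>; the other two come from \<open>s\<^sup>2\<close> and \<open>(b - y)\<^sup>2\<close>.\<close>
  let ?F = "\<lambda>y. (p * B + q * A) * ((b - a) * (y - a)\<^sup>2 / 2 - (y - a) ^ 3 / 3)
                + q * B * (y - a) ^ 3 / 3 - p * A * (b - y) ^ 3 / 3"
  have "(?F has_field_derivative (p * (b - y) + q * (y - a)) * (A * (b - y) + B * (y - a)))
          (at y within {a..b})" for y
    by (auto intro!: derivative_eq_intros simp: field_simps power2_eq_square)
  then have "((\<lambda>y. (p * (b - y) + q * (y - a)) * (A * (b - y) + B * (y - a)))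
               has_integral ?F b - ?F a) {a..b}"
    using assms
    by (intro fundamental_theorem_of_calculus) (auto simp: has_real_derivative_iff_has_vector_derivative)
  moreover have "?F b - ?F a = (b - a) ^ 3 / 6 * ((2 * p + q) * A + (p + 2 * q) * B)"
    by (simp add: field_simps power2_eq_square power3_eq_cube)
  ultimately show ?thesis
    by (simp only:)
qed

text \<open>
  The estimate on one piece: compare \<open>\<bar>f'\<bar>\<close> with its chord under the nonnegative weight
  from the integration by parts.
\<close>

lemma by_parts_chord_bound:
  fixes f f' :: "real \<Rightarrow> real"
  assumes "a \<le> b" "0 \<le> p" "0 \<le> q"
    and f': "\<And>y. y \<in> {a..b} \<Longrightarrow> (f has_field_derivative f' y) (at y within {a..b})"
    and convex: "convex_on {a..b} (\<lambda>y. \<bar>f' y\<bar>)"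
  shows "\<bar>(b - a) * (q * f b - p * f a) - (q - p) * integral {a..b} f\<bar>
           \<le> (b - a)\<^sup>2 / 6 * ((2 * p + q) * \<bar>f' a\<bar> + (p + 2 * q) * \<bar>f' b\<bar>)"
proof (cases "a = b")
  case True
  then show ?thesis by simp
next
  case False
  with \<open>a \<le> b\<close> have "a < b" by simp
  let ?W = "\<lambda>y. p * (b - y) + q * (y - a)"
  let ?C = "\<lambda>y. \<bar>f' a\<bar> * (b - y) + \<bar>f' b\<bar> * (y - a)"
  have parts: "((\<lambda>y. ?W y * f' y) has_integral
                 (b - a) * (q * f b - p * f a) - (q - p) * integral {a..b} f) {a..b}"
    by (intro affine_by_parts_has_integral \<open>a \<le> b\<close> f')
  have "(b - a) ^ 3 / 6 * K / (b - a) = (b - a)\<^sup>2 / 6 * K" for K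
    using \<open>a < b\<close> by (simp add: power2_eq_square power3_eq_cube field_simps)
  moreover have "((\<lambda>y. ?W y * ?C y / (b - a)) has_integral
          (b - a) ^ 3 / 6 * ((2 * p + q) * \<bar>f' a\<bar> + (p + 2 * q) * \<bar>f' b\<bar>) / (b - a)) {a..b}"
    by (intro has_integral_divide affine_product_has_integral \<open>a \<le> b\<close>)
  ultimately have majorant: "((\<lambda>y. ?W y * ?C y / (b - a)) has_integral
          (b - a)\<^sup>2 / 6 * ((2 * p + q) * \<bar>f' a\<bar> + (p + 2 * q) * \<bar>f' b\<bar>)) {a..b}"
    by (simp only:)
  have bound: "norm (?W y * f' y) \<le> ?W y * ?C y / (b - a)" if y: "y \<in> {a..b}" for y
  proof -
    have "0 \<le> ?W y"
      using y \<open>0 \<le> p\<close> \<open>0 \<le> q\<close> by simp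
    have "\<bar>f' y\<bar> \<le> (\<bar>f' b\<bar> - \<bar>f' a\<bar>) / (b - a) * (y - a) + \<bar>f' a\<bar>"
      using convex_onD_Icc'[OF convex y] by simp
    also have "\<dots> = ?C y / (b - a)"
      using \<open>a < b\<close> by (simp add: field_simps)
    finally have "?W y * \<bar>f' y\<bar> \<le> ?W y * (?C y / (b - a))"
      using \<open>0 \<le> ?W y\<close> by (rule mult_left_mono)
    then show ?thesis
      using \<open>0 \<le> ?W y\<close> by (simp add: abs_mult)
  qed
  have "norm (integral {a..b} (\<lambda>y. ?W y * f' y)) \<le> integral {a..b} (\<lambda>y. ?W y * ?C y / (b - a))"
    by (rule integral_norm_bound_integral[OF has_integral_integrable[OF parts]
          has_integral_integrable[OF majorant] bound])
  then show ?thesis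
    unfolding integral_unique[OF parts] integral_unique[OF majorant] by simp
qed

theorem theorem3:
  fixes f :: "real \<Rightarrow> real" and u v :: real
  assumes "f differentiable_on {0<..}"
    and "0 < u" and "u < v"
    and "set_integrable lebesgue {u..v} (deriv f)"
    and "convex_on {u..v} (\<lambda>t. \<bar>deriv f t\<bar>)"
  shows "\<forall>x\<in>{u..v}.
    \<bar>((v - x) * (v * f v - u * f x) + (x - u) * (v * f x - u * f u)) / (v - u)\<^sup>2
       - 1 / (v - u) * (LINT \<mu>:{u..v}|lebesgue. f \<mu>)\<bar>
    \<le> (v - x)\<^sup>2 / (6 * (v - u)\<^sup>2) * ((2 * u + v) * \<bar>deriv f x\<bar> + (u + 2 * v) * \<bar>deriv f v\<bar>)
      + (x - u)\<^sup>2 / (6 * (v - u)\<^sup>2) * ((u + 2 * v) * \<bar>deriv f x\<bar> + (2 * u + v) * \<bar>deriv f u\<bar>)"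
proof
  fix x assume x: "x \<in> {u..v}"
  have deriv: "(f has_field_derivative deriv f y) (at y within S)" if "0 < y" for y S
  proof -
    have "f differentiable at y"
      using assms(1) that by (simp add: differentiable_on_eq_differentiable_at)
    then show ?thesis
      by (simp add: DERIV_deriv_iff_real_differentiable has_field_derivative_at_within)
  qed
  have cont: "continuous_on {u..v} f"
    using \<open>0 < u\<close> by (intro DERIV_continuous_on[where D = "deriv f"] deriv) auto
  have lebesgue_eq: "(LINT \<mu>:{u..v}|lebesgue. f \<mu>) = integral {u..v} f"
    by (intro set_lebesgue_integral_eq_integral(2) absolutely_integrable_continuous_real cont)
  have split: "integral {u..v} f = integral {u..x} f + integral {x..v} f"
    using x cont by (simp add: Henstock_Kurzweil_Integration.integral_combine integrable_continuous_real)

  let ?L1 = "(x - u) * (v * f x - u * f u) - (v - u) * integral {u..x} f"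
  let ?L2 = "(v - x) * (v * f v - u * f x) - (v - u) * integral {x..v} f"
  let ?R1 = "(x - u)\<^sup>2 / 6 * ((2 * u + v) * \<bar>deriv f u\<bar> + (u + 2 * v) * \<bar>deriv f x\<bar>)"
  let ?R2 = "(v - x)\<^sup>2 / 6 * ((2 * u + v) * \<bar>deriv f x\<bar> + (u + 2 * v) * \<bar>deriv f v\<bar>)"
  have "\<bar>?L1\<bar> \<le> ?R1"
    using assms x
    by (intro by_parts_chord_bound deriv convex_on_subset[OF assms(5)]) auto
  moreover have "\<bar>?L2\<bar> \<le> ?R2"
    using assms x
    by (intro by_parts_chord_bound deriv convex_on_subset[OF assms(5)]) auto
  ultimately have "\<bar>?L1 + ?L2\<bar> \<le> ?R1 + ?R2"
    by linarith
  then have "\<bar>(?L1 + ?L2) / (v - u)\<^sup>2\<bar> \<le> (?R1 + ?R2) / (v - u)\<^sup>2"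
    by (simp add: divide_right_mono)
  moreover have "(?L1 + ?L2) / (v - u)\<^sup>2 =
      ((v - x) * (v * f v - u * f x) + (x - u) * (v * f x - u * f u)) / (v - u)\<^sup>2
       - 1 / (v - u) * (LINT \<mu>:{u..v}|lebesgue. f \<mu>)"
  proof -
    have "?L1 + ?L2 = (v - x) * (v * f v - u * f x) + (x - u) * (v * f x - u * f u)
            - (v - u) * integral {u..v} f"
      unfolding split by (simp add: algebra_simps)
    then show ?thesis
      using \<open>u < v\<close>
      by (simp only: lebesgue_eq diff_divide_distrib) (simp add: power2_eq_square)
  qed
  moreover have "(?R1 + ?R2) / (v - u)\<^sup>2 =
      (v - x)\<^sup>2 / (6 * (v - u)\<^sup>2) * ((2 * u + v) * \<bar>deriv f x\<bar> + (u + 2 * v) * \<bar>deriv f v\<bar>)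
      + (x - u)\<^sup>2 / (6 * (v - u)\<^sup>2) * ((u + 2 * v) * \<bar>deriv f x\<bar> + (2 * u + v) * \<bar>deriv f u\<bar>)"
    by (simp add: add_divide_distrib add.commute)
  ultimately show "\<bar>((v - x) * (v * f v - u * f x) + (x - u) * (v * f x - u * f u)) / (v - u)\<^sup>2
       - 1 / (v - u) * (LINT \<mu>:{u..v}|lebesgue. f \<mu>)\<bar>
    \<le> (v - x)\<^sup>2 / (6 * (v - u)\<^sup>2) * ((2 * u + v) * \<bar>deriv f x\<bar> + (u + 2 * v) * \<bar>deriv f v\<bar>)
      + (x - u)\<^sup>2 / (6 * (v - u)\<^sup>2) * ((u + 2 * v) * \<bar>deriv f x\<bar> + (2 * u + v) * \<bar>deriv f u\<bar>)"
    by metis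
qed

end
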